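(* Let $P_d>1$ be an integer and let $g_0$ be the impulse response of a finite-dimensional causal discrete-time LTI system such that $g_0\in\ell_1$, $g_0(0)>0$, the support of $g_0$ is $\mathbb{Z}_{\ge 0}$, $g_0$ is strictly monotonically decreasing on its support, and $g_0$ is convex on its support. Consider the delayed relay feedback system $$u(t)=-\mathcal{C}_{g_0}(\mathrm{sign}(u))(t-P_d),\qquad t\in\mathbb{Z}. \qquad ( * )$$ Then for every integer $P\ge P_d$ and every $P$-periodic $u$ that satisfies $( * )$, $S_c^-(\Delta_c u^P)=2$ and $S_c^+(u^P)=2$, it holds that $$2P_d\le P\le 4P_d+2.$$
   Context: Finite-dimensional causal LTI system: its impulse response $g_0:\mathbb{Z}\to\mathbb{R}$ satisfies $g_0(t)=0$ for $t<0$ and $G_0(z)=\sum_{t\ge 0}g_0(t)z^{-t}$ is rational. $g_0\in\ell_1$ means $\sum_{t}|g_0(t)|<\infty$. Convex on its support $\mathbb{Z}_{\ge 0}$ means $g_0(t+1)-g_0(t)\ge g_0(t)-g_0(t-1)$ for all $t\ge 1$. The convolution operator is $\mathcal{C}_{g_0}(w)(t):=\sum_{\tau\in\mathbb{Z}}g_0(t-\tau)w(\tau)$ for bounded $w$. For a $P$-periodic sequence $x$, $x^P:=[x(0),\dots,x(P-1)]^\top$. $\mathrm{sign}(t)=1,0,-1$ for $t>0$, $t=0$, $t<0$, applied entrywise. Cyclic forward difference: for $v\in\mathbb{R}^n$, $\Delta_c v:=[v_2-v_1,\,v_3-v_2,\dots,v_1-v_n]^\top$. Variation: $S^-(v)$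 is the number of sign changes between consecutive entries of the vector obtained from $v$ by deleting all zeros, with $S^-(0)=-1$. Cyclic variation: $S_c^-(v):=\max_{1\le i\le n}S^-([v_i,\dots,v_n,v_1,\dots,v_i])$. $S_c^+(v)$ is the maximum of $S_c^-(\bar v)$ over all $\bar v\in\mathbb{R}^n$ obtained from $v$ by replacing its zero entries by arbitrary real numbers. *)

theory Defs
  imports "HOL-Analysis.Analysis" "HOL-Computational_Algebra.Polynomial"
begin

text \<open>
  The transfer function is the sum of the series of \<open>g t\<close> times \<open>z\<close> to the power \<open>-t\<close>, which is
  only meaningful where that series converges; rationality is therefore required on some
  neighbourhood of infinity.
\<close>

definition finite_dim_causal_lti :: "(int \<Rightarrow> real) \<Rightarrow> bool" where
  "finite_dim_causal_lti g \<longleftrightarrow>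
     (\<forall>t<0. g t = 0) \<and>
     (\<exists>(p :: complex poly) (q :: complex poly) R. q \<noteq> 0 \<and>
        (\<forall>z. norm z > R \<longrightarrow>
           (\<lambda>n. complex_of_real (g (int n)) * z powi (- int n)) sums (poly p z / poly q z)))"

definition convex_seq :: "(int \<Rightarrow> real) \<Rightarrow> bool" where
  "convex_seq g \<longleftrightarrow> (\<forall>t\<ge>1. g (t + 1) - g t \<ge> g t - g (t - 1))"

definition conv_op :: "(int \<Rightarrow> real) \<Rightarrow> (int \<Rightarrow> real) \<Rightarrow> int \<Rightarrow> real" where
  "conv_op g w t = (\<Sum>\<^sub>\<infinity>\<tau>\<in>UNIV. g (t - \<tau>) * w \<tau>)"

definition delayed_relay_feedback :: "(int \<Rightarrow> real) \<Rightarrow> nat \<Rightarrow> (int \<Rightarrow> real) \<Rightarrow> bool" where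
  "delayed_relay_feedback g d u \<longleftrightarrow>
     (\<forall>t. u t = - conv_op g (\<lambda>\<tau>. sgn (u \<tau>)) (t - int d))"

definition periodic_seq :: "nat \<Rightarrow> (int \<Rightarrow> real) \<Rightarrow> bool" where
  "periodic_seq P u \<longleftrightarrow> (\<forall>t. u (t + int P) = u t)"

text \<open>
  Vectors whose dimension is a term (such as the period) are lists, indexed from 0.
\<close>

definition period_vec :: "nat \<Rightarrow> (int \<Rightarrow> real) \<Rightarrow> real list" where
  "period_vec P u = map (\<lambda>i. u (int i)) [0..<P]"

definition cyclic_diff :: "real list \<Rightarrow> real list" where
  "cyclic_diff v = map (\<lambda>i. v ! ((i + 1) mod length v) - v ! i) [0..<length v]"

definition variation :: "real list \<Rightarrow> int" where
  "variation v =
     (let w = filter (\<lambda>x. x \<noteq> 0) v in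
      if w = [] then -1
      else int (card {i. i + 1 < length w \<and> sgn (w ! i) \<noteq> sgn (w ! (i + 1))}))"

text \<open>
  The two cyclic variations below are only meaningful for nonempty lists.
\<close>

definition cyclic_variation :: "real list \<Rightarrow> int" where
  "cyclic_variation v =
     Max ((\<lambda>i. variation (drop i v @ take (i + 1) v)) ` {..<length v})"

definition zero_fillings :: "real list \<Rightarrow> real list set" where
  "zero_fillings v =
     {w. length w = length v \<and> (\<forall>i<length v. v ! i \<noteq> 0 \<longrightarrow> w ! i = v ! i)}"

text \<open>
  Although \<open>zero_fillings v\<close> is infinite in general, the maximum exists: the cyclic variations
  of lists of a fixed positive length form a finite set.
\<close>

definition max_cyclic_variation :: "real list \<Rightarrow> int" where
  "max_cyclic_variation v = Max (cyclic_variation ` zero_fillings v)"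

lemma variation_bounds: "variation v \<in> {-1..int (length v)}"
proof -
  define w where "w = filter (\<lambda>x. x \<noteq> 0) v"
  have "card {i. i + 1 < length w \<and> sgn (w ! i) \<noteq> sgn (w ! (i + 1))} \<le> card {..<length w}"
    by (rule card_mono) auto
  also have "\<dots> \<le> length v"
    by (simp add: w_def)
  finally show ?thesis
    by (auto simp: variation_def Let_def w_def)
qed

lemma finite_cyclic_variation_zero_fillings:
  assumes "v \<noteq> []"
  shows "finite (cyclic_variation ` zero_fillings v)"
proof (rule finite_subset)
  show "cyclic_variation ` zero_fillings v \<subseteq> {-1..int (2 * length v + 1)}"
  proof
    fix k assume "k \<in> cyclic_variation ` zero_fillings v"
    then obtain w where w: "length w = length v" and k: "k = cyclic_variation w"
      by (auto simp: zero_fillings_def)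
    let ?A = "(\<lambda>i. variation (drop i w @ take (i + 1) w)) ` {..<length w}"
    have "k \<in> ?A"
      unfolding k cyclic_variation_def by (rule Max_in) (use w assms in auto)
    then obtain i where "k = variation (drop i w @ take (i + 1) w)" "i < length w"
      by auto
    with variation_bounds[of "drop i w @ take (i + 1) w"] w
    show "k \<in> {-1..int (2 * length v + 1)}"
      by auto
  qed
qed simp

end

theory Submission
  imports Defs
begin

text \<open>
  Let \<open>w = sgn u\<close>, let \<open>d\<close> be the delay and \<open>y\<close> the response of the system to \<open>w\<close>, so that
  \<open>w (t + d) = - sgn (y t)\<close>. Three ideas give the bounds.

  Shape of \<open>w\<close>. The condition on the maximal cyclic variation forbids four cyclically ordered,
  weakly alternating values of \<open>u\<close>, because the zeros among them could be filled so as to produce four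
  sign changes. The dynamics force \<open>u\<close> to take both signs. Hence one period of \<open>w\<close>, suitably shifted,
  consists of \<open>K\<close> ones, \<open>a\<close> zeros, \<open>M\<close> minus ones and \<open>b\<close> zeros, with \<open>a, b \<le> 1\<close>
  (\<open>exists_square_wave_shift\<close>).

  Shape of \<open>y\<close>. Summing the impulse response over residue classes modulo the period turns the
  convolution into a cyclic one whose kernel is again nonnegative, decreasing and convex
  (\<open>conv_op_eq_cyclic_conv\<close>). The response to the square wave is therefore explicit: on the negative
  phase it decreases and is convex (\<open>falling_branch\<close>), and by the symmetry
  \<open>w \<mapsto> - w (\<cdot> + K + a)\<close> it increases and is concave on the positive phase.

  Lower bound. The maximum of \<open>y\<close> is positive and is attained where \<open>w\<close> leaves its positive phase;
  after the delay it must meet a minus one of \<open>w\<close>, so \<open>d \<le> M + a\<close> (\<open>delay_le_negative_phase\<close>). By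
  symmetry \<open>d \<le> K + b\<close>, and adding the two gives \<open>2 d \<le> P\<close>.

  Upper bound. Let the negative phase be the longer one. The trough of \<open>y\<close> is then at least as deep
  as its peak is high: the two ends of the falling branch have a nonpositive sum
  (\<open>falling_branch_ends\<close>). By convexity the sum of any two symmetric points of the branch is
  nonpositive too. The value \<open>d\<close> steps before the end is still positive, since \<open>w\<close> is negative at the
  end; hence the value \<open>d\<close> steps after the start is already negative, and monotonicity gives \<open>M < 2 d\<close>
  (\<open>negative_phase_less_double_delay\<close>). So both phases are shorter than \<open>2 d\<close>.
\<close>

section \<open>Convex sequences\<close>

definition increasing_differences :: "(nat \<Rightarrow> real) \<Rightarrow> bool" where
  "increasing_differences f \<longleftrightarrow> (\<forall>n. f (Suc n) - f n \<le> f (Suc (Suc n)) - f (Suc n))"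

lemma increasing_differences_mono:
  assumes "increasing_differences f"
  shows "mono (\<lambda>n. f (n + k) - f n)"
proof -
  have "incseq (\<lambda>n. f (Suc n) - f n)"
    using assms by (intro incseq_SucI) (simp add: increasing_differences_def)
  then have step: "f (Suc n) - f n \<le> f (Suc (n + k)) - f (n + k)" for n
    by (auto simp: incseq_def)
  show ?thesis
  proof (intro incseq_SucI)
    fix n
    show "f (n + k) - f n \<le> f (Suc n + k) - f (Suc n)"
      using step[of n] by simp
  qed
qed

text \<open>
  The first \<open>j\<close> increments of a convex sequence do not exceed the last \<open>j\<close> increments before \<open>m\<close>.
\<close>

lemma convex_symmetric_pair_le_ends:
  assumes "increasing_differences f" "j \<le> m"
  shows "f j + f (m - j) \<le> f 0 + f m"
  using monoD[OF increasing_differences_mono[OF assms(1), of j], of 0 "m - j"] assms(2) by simp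

section \<open>Cyclic convolution with a square wave\<close>

definition cyclic_conv :: "(nat \<Rightarrow> real) \<Rightarrow> nat \<Rightarrow> (int \<Rightarrow> real) \<Rightarrow> int \<Rightarrow> real" where
  "cyclic_conv h P w t = (\<Sum>j<P. h j * w (t - int j))"

text \<open>
  The parameters \<open>a\<close> and \<open>b\<close> count the zeros that a relay may output while the signal switches sign.
\<close>

definition square_wave :: "nat \<Rightarrow> nat \<Rightarrow> nat \<Rightarrow> nat \<Rightarrow> (int \<Rightarrow> real) \<Rightarrow> bool" where
  "square_wave K a M b w \<longleftrightarrow>
     K \<ge> 1 \<and> M \<ge> 1 \<and> a \<le> 1 \<and> b \<le> 1 \<and> periodic_seq (K + a + M + b) w \<and>
     (\<forall>t. 0 \<le> t \<and> t < int K \<longrightarrow> w t = 1) \<and>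
     (\<forall>t. int K \<le> t \<and> t < int (K + a) \<longrightarrow> w t = 0) \<and>
     (\<forall>t. int (K + a) \<le> t \<and> t < int (K + a + M) \<longrightarrow> w t = - 1) \<and>
     (\<forall>t. int (K + a + M) \<le> t \<and> t < int (K + a + M + b) \<longrightarrow> w t = 0)"

lemma periodic_seq_mult:
  assumes "periodic_seq P w"
  shows "w (t + int P * k) = w t"
proof -
  have nat: "w (t + int P * int n) = w t" for t n
  proof (induction n)
    case (Suc n)
    have "w (t + int P * int (Suc n)) = w ((t + int P * int n) + int P)"
      by (simp add: algebra_simps)
    with Suc assms show ?case by (simp add: periodic_seq_def)
  qed simp
  show ?thesis
  proof (cases "k \<ge> 0")
    case True
    then show ?thesis using nat[of t "nat k"] by simp
  next
    case False
    then show ?thesis using nat[of "t + int P * k" "nat (- k)"] by simp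
  qed
qed

lemma periodic_seq_mod:
  assumes "periodic_seq P w"
  shows "w (t mod int P) = w t"
  using periodic_seq_mult[OF assms, of "t mod int P" "t div int P"] by simp

text \<open>
  This symmetry exchanges the two phases, so that everything about the positive phase follows
  from the corresponding fact about the negative one.
\<close>

lemma square_wave_half_turn:
  assumes "square_wave K a M b w"
  shows "square_wave M b K a (\<lambda>t. - w (t + int (K + a)))"
proof -
  have per: "w (t + int (K + a + M + b)) = w t" for t
    using assms by (simp add: square_wave_def periodic_seq_def)
  have shift: "w (t + int (K + a)) = w (t - int (M + b))" for t
    using per[of "t - int (M + b)"] by (simp add: algebra_simps)
  have "w (t + int (K + a) + int (K + a + M + b)) = w (t + int (K + a))" for t
    by (rule per)
  then have "periodic_seq (M + b + K + a) (\<lambda>t. - w (t + int (K + a)))"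
    by (simp add: periodic_seq_def algebra_simps)
  moreover have "- w (t + int (K + a)) = 1" if "0 \<le> t" "t < int M" for t
    using assms that by (simp add: square_wave_def)
  moreover have "- w (t + int (K + a)) = 0" if "int M \<le> t" "t < int (M + b)" for t
    using assms that by (simp add: square_wave_def)
  moreover have "- w (t + int (K + a)) = - 1" if "int (M + b) \<le> t" "t < int (M + b + K)" for t
    using assms that unfolding shift by (simp add: square_wave_def)
  moreover have "- w (t + int (K + a)) = 0" if "int (M + b + K) \<le> t" "t < int (M + b + K + a)" for t
    using assms that unfolding shift by (simp add: square_wave_def)
  ultimately show ?thesis
    using assms by (auto simp: square_wave_def)
qed

lemma cyclic_conv_periodic:
  assumes "periodic_seq P w"
  shows "cyclic_conv h P w (t + int P) = cyclic_conv h P w t"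
proof -
  have "w (t + int P - int j) = w (t - int j)" for j
    using assms[unfolded periodic_seq_def, rule_format, of "t - int j"] by (simp add: algebra_simps)
  then show ?thesis by (simp add: cyclic_conv_def)
qed

lemma cyclic_conv_shift_neg:
  "cyclic_conv h P (\<lambda>t. - w (t + s)) t = - cyclic_conv h P w (t + s)"
  by (simp add: cyclic_conv_def sum_negf algebra_simps)

text \<open>
  This is the response to a square wave \<open>i\<close> steps after the last index before its negative phase: looking
  back from there one sees \<open>i\<close> minus ones, \<open>a\<close> zeros, \<open>K\<close> ones, \<open>b\<close> zeros and then the minus ones of
  the previous period. Partial sums instead of sums over these blocks keep the formula meaningful for
  all \<open>i\<close>, so that its monotonicity and convexity need no bound on \<open>i\<close>.
\<close>

definition falling_branch :: "(nat \<Rightarrow> real) \<Rightarrow> nat \<Rightarrow> nat \<Rightarrow> nat \<Rightarrow> nat \<Rightarrow> nat \<Rightarrow> real" where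
  "falling_branch h K a M b i =
     (sum h {..<i + a + K} - sum h {..<i + a}) - sum h {..<i}
     - (sum h {..<K + a + M + b} - sum h {..<i + a + K + b})"

lemma cyclic_conv_square_wave:
  assumes sq: "square_wave K a M b w" and i: "i \<le> M"
  shows "cyclic_conv h (K + a + M + b) w (int (K + a + i) - 1) = falling_branch h K a M b i"
proof -
  define P where "P = K + a + M + b"
  define f where "f j = h j * w (int (K + a + i) - 1 - int j)" for j
  have per: "w t = w (t + int P)" for t
    using sq by (simp add: square_wave_def periodic_seq_def P_def)
  have split: "sum q {m..<n} = sum q {..<n} - sum q {..<m}" if "m \<le> n" for q :: "nat \<Rightarrow> real" and m n
    using sum.atLeastLessThan_concat[of 0 m n q] that by (simp add: atLeast0LessThan)
  \<comment> \<open>The last two blocks reach indices below \<open>0\<close>, where the values come from one period later.\<close>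
  have "sum f {..<i} = (\<Sum>j<i. - h j)"
  proof (rule sum.cong)
    fix j assume "j \<in> {..<i}"
    then have "w (int (K + a + i) - 1 - int j) = - 1"
      using sq i by (auto simp: square_wave_def)
    then show "f j = - h j" by (simp add: f_def)
  qed simp
  moreover have "sum f {i..<i + a} = 0"
  proof (rule sum.neutral, rule ballI)
    fix j assume "j \<in> {i..<i + a}"
    then have "w (int (K + a + i) - 1 - int j) = 0"
      using sq i by (auto simp: square_wave_def)
    then show "f j = 0" by (simp add: f_def)
  qed
  moreover have "sum f {i + a..<i + a + K} = sum h {i + a..<i + a + K}"
  proof (rule sum.cong)
    fix j assume "j \<in> {i + a..<i + a + K}"
    then have "w (int (K + a + i) - 1 - int j) = 1"
      using sq i by (auto simp: square_wave_def)
    then show "f j = h j" by (simp add: f_def)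
  qed simp
  moreover have "sum f {i + a + K..<i + a + K + b} = 0"
  proof (rule sum.neutral, rule ballI)
    fix j assume "j \<in> {i + a + K..<i + a + K + b}"
    then have "w (int (K + a + i) - 1 - int j + int P) = 0"
      using sq i by (auto simp: square_wave_def P_def)
    then show "f j = 0" by (simp add: f_def flip: per)
  qed
  moreover have "sum f {i + a + K + b..<P} = (\<Sum>j\<in>{i + a + K + b..<P}. - h j)"
  proof (rule sum.cong)
    fix j assume "j \<in> {i + a + K + b..<P}"
    then have "w (int (K + a + i) - 1 - int j + int P) = - 1"
      using sq i by (auto simp: square_wave_def P_def)
    then show "f j = - h j" by (simp add: f_def flip: per)
  qed simp
  moreover have "i + a + K + b \<le> P"
    using i by (simp add: P_def)
  ultimately have "sum f {..<P} =
      (sum h {..<i + a + K} - sum h {..<i + a}) - sum h {..<i} - (sum h {..<P} - sum h {..<i + a + K + b})"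
    by (simp add: split sum_negf)
  then show ?thesis
    by (simp add: cyclic_conv_def f_def P_def falling_branch_def)
qed

lemma falling_branch_Suc:
  "falling_branch h K a M b (Suc i) - falling_branch h K a M b i =
     (h (i + (a + K)) - h i) + (h (i + a + (K + b)) - h (i + a))"
  by (simp add: falling_branch_def algebra_simps)

lemma falling_branch_antimono:
  assumes "antimono h"
  shows "antimono (falling_branch h K a M b)"
proof (rule decseq_SucI)
  fix i
  show "falling_branch h K a M b (Suc i) \<le> falling_branch h K a M b i"
    using falling_branch_Suc[of h K a M b i]
      antimonoD[OF assms, of i "i + (a + K)"] antimonoD[OF assms, of "i + a" "i + a + (K + b)"]
    by simp
qed

lemma falling_branch_convex:
  assumes "increasing_differences h"
  shows "increasing_differences (falling_branch h K a M b)"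
  unfolding increasing_differences_def falling_branch_Suc
proof
  fix i
  show "(h (i + (a + K)) - h i) + (h (i + a + (K + b)) - h (i + a))
    \<le> (h (Suc i + (a + K)) - h (Suc i)) + (h (Suc i + a + (K + b)) - h (Suc i + a))"
    using monoD[OF increasing_differences_mono[OF assms, of "a + K"], of i "Suc i"]
      monoD[OF increasing_differences_mono[OF assms, of "K + b"], of "i + a" "Suc i + a"]
    by linarith
qed

lemma block_sum_antimono:
  fixes h :: "nat \<Rightarrow> real"
  assumes "antimono h" "m \<le> n"
  shows "sum h {..<n + k} - sum h {..<n} \<le> sum h {..<m + k} - sum h {..<m}"
proof (induction k)
  case (Suc k)
  then show ?case using antimonoD[OF assms(1), of "m + k" "n + k"] assms(2) by simp
qed simp

text \<open>
  At the start of the branch the recent part of the kernel is weighted by the ones, at the end by the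
  minus ones. If the negative phase is strictly longer, each block of ones in the sum of the two values
  is outweighed by a block of minus ones that lies no further back. For phases of equal length with one
  zero at either switch that comparison fails by one index, and convexity of the kernel takes its place.
  For equal lengths and \<open>b > a\<close> the claim itself can fail; then the half turn has \<open>a\<close> and \<open>b\<close>
  exchanged and satisfies the hypothesis.
\<close>

lemma falling_branch_ends:
  assumes "antimono h" "increasing_differences h" "\<And>n. 0 \<le> h n"
    and "a \<le> 1" "b \<le> 1" and major: "K < M \<or> K = M \<and> b \<le> a"
  shows "falling_branch h K a M b 0 + falling_branch h K a M b M \<le> 0"
proof -
  let ?H = "\<lambda>n. sum h {..<n}"
  have eq: "falling_branch h K a M b 0 + falling_branch h K a M b M =
      (?H (a + K) - ?H a - ?H M) + (?H (M + a + K) - ?H (M + a)) - (?H (K + a + M + b) - ?H (a + K + b))"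
    by (simp add: falling_branch_def algebra_simps)
  have mono: "?H m \<le> ?H n" if "m \<le> n" for m n
    using that assms(3) by (intro sum_mono2) auto
  show ?thesis
  proof (cases "K + b \<le> M")
    case True
    have "?H (a + K) - ?H a \<le> ?H K"
      using block_sum_antimono[OF assms(1), of 0 a K] by simp
    moreover have "?H K \<le> ?H M" using True by (intro mono) simp
    moreover have "?H (M + a + K) - ?H (M + a) \<le> ?H (a + K + b + K) - ?H (a + K + b)"
      using True by (intro block_sum_antimono[OF assms(1)]) simp
    moreover have "?H (a + K + b + K) \<le> ?H (K + a + M + b)"
      using True by (intro mono) simp
    ultimately show ?thesis unfolding eq by linarith
  next
    case False
    with major assms(4,5) have [simp]: "M = K" "b = 1" "a = 1" by auto
    have "h K - h 0 \<le> h (Suc K + K) - h (Suc K)"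
      using monoD[OF increasing_differences_mono[OF assms(2), of K], of 0 "Suc K"] by simp
    then show ?thesis unfolding eq by (simp add: algebra_simps)
  qed
qed

section \<open>Self-oscillation of a delayed relay loop\<close>

definition relay_loop :: "(nat \<Rightarrow> real) \<Rightarrow> nat \<Rightarrow> nat \<Rightarrow> (int \<Rightarrow> real) \<Rightarrow> bool" where
  "relay_loop h P d w \<longleftrightarrow> (\<forall>t. w (t + int d) = - sgn (cyclic_conv h P w t))"

lemma relay_loop_half_turn:
  assumes "relay_loop h P d w"
  shows "relay_loop h P d (\<lambda>t. - w (t + s))"
  unfolding relay_loop_def cyclic_conv_shift_neg
proof
  fix t
  show "- w (t + int d + s) = - sgn (- cyclic_conv h P w (t + s))"
    using assms[unfolded relay_loop_def, rule_format, of "t + s"]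
    by (simp add: algebra_simps sgn_minus)
qed

text \<open>
  If the delay were longer, \<open>w\<close> would be nonnegative \<open>d\<close> steps after the peak of the response.
  Then the peak would be nonpositive, hence so would the whole response, and the relay would never
  output minus one.
\<close>

lemma delay_le_negative_phase:
  assumes sq: "square_wave K a M b w" and loop: "relay_loop h (K + a + M + b) d w"
    and h: "antimono h" and d: "1 < d" "d \<le> K + a + M + b"
  shows "d \<le> M + a"
proof (rule ccontr)
  assume "\<not> d \<le> M + a"
  then have dl: "M + a < d" by simp
  define P where "P = K + a + M + b"
  define y where "y = cyclic_conv h P w"
  have a: "a \<le> 1" "b \<le> 1" "K \<ge> 1" "M \<ge> 1" using sq by (auto simp: square_wave_def)
  have per: "periodic_seq P w" using sq by (simp add: square_wave_def P_def)
  have wper: "w (t + int P) = w t" for t using per by (simp add: periodic_seq_def)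
  have w: "w (t + int d) = - sgn (y t)" for t
    using loop by (simp add: relay_loop_def y_def P_def)
  have nonpos: "y t \<le> 0" if "w (t + int d) \<ge> 0" for t
    using that unfolding w by (simp add: sgn_if split: if_splits)
  have w_nonneg: "w t \<ge> 0" if "int (K + a + M) \<le> t" "t < int (P + K + a)" for t
  proof (cases "t < int P")
    case True
    then have "w t = 0" using sq that unfolding square_wave_def P_def by blast
    then show ?thesis by simp
  next
    case False
    have "w (t - int P) = 1 \<or> w (t - int P) = 0"
    proof (cases "t - int P < int K")
      case True
      then have "w (t - int P) = 1" using sq False unfolding square_wave_def by simp
      then show ?thesis by simp
    next
      case False
      then have "w (t - int P) = 0" using sq that unfolding square_wave_def by simp
      then show ?thesis by simp
    qed
    then show ?thesis using wper[of "t - int P"] by auto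
  qed
  \<comment> \<open>If \<open>a = 1\<close>, the peak may be on either side of the zero of \<open>w\<close>; both candidates are needed.\<close>
  have top1: "y (int (K + a) - 1) \<le> 0"
    using d dl a by (intro nonpos w_nonneg) (auto simp: P_def)
  have top2: "y (int K - 1) \<le> 0"
    using d dl a by (intro nonpos w_nonneg) (auto simp: P_def)
  have fall: "y t \<le> 0" if t: "int (K + a) - 1 \<le> t" "t < int (K + a + M)" for t
  proof -
    obtain i where i: "t = int (K + a + i) - 1" "i \<le> M"
      using t by (intro that[of "nat (t + 1 - int (K + a))"]) auto
    have "y t = falling_branch h K a M b i"
      using cyclic_conv_square_wave[OF sq i(2)] by (simp add: y_def P_def i(1))
    also have "\<dots> \<le> falling_branch h K a M b 0"
      using antimonoD[OF falling_branch_antimono[OF h]] by simp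
    also have "\<dots> = y (int (K + a) - 1)"
      using cyclic_conv_square_wave[OF sq, of 0] by (simp add: y_def P_def)
    finally show ?thesis using top1 by simp
  qed
  have rise: "y t \<le> 0" if t: "int P - 1 \<le> t" "t < int (P + K)" for t
  proof -
    have eq: "falling_branch h M b K a i = - y (int (P + i) - 1)" if "i \<le> K" for i
      using cyclic_conv_square_wave[OF square_wave_half_turn[OF sq] that, of h]
      unfolding cyclic_conv_shift_neg by (simp add: y_def P_def algebra_simps)
    obtain i where i: "t = int (P + i) - 1" "i \<le> K"
      using t by (intro that[of "nat (t + 1 - int P)"]) auto
    have "falling_branch h M b K a K \<le> falling_branch h M b K a i"
      using antimonoD[OF falling_branch_antimono[OF h]] i by simp
    then have "y t \<le> y (int K - 1 + int P)"
      using i(2) unfolding i(1) by (simp add: eq algebra_simps)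
    also have "\<dots> = y (int K - 1)"
      using cyclic_conv_periodic[OF per] by (simp add: y_def)
    finally show ?thesis using top2 by simp
  qed
  \<comment> \<open>The response that triggers the first minus one, moved by a period into the union of both branches.\<close>
  define r where "r = int (K + a) - int d + int P"
  have "w (int (K + a)) = - 1" using sq a by (simp add: square_wave_def)
  moreover have "w (r + int d) = w (int (K + a))"
    using wper[of "int (K + a)"] by (simp add: r_def add.assoc)
  ultimately have "y r > 0" using w[of r] by (simp add: sgn_if split: if_splits)
  moreover have "y r \<le> 0"
  proof (cases "r < int (K + a + M)")
    case True
    then show ?thesis using d by (intro fall) (auto simp: r_def P_def)
  next
    case False
    then show ?thesis using d a by (intro rise) (auto simp: r_def P_def)
  qed
  ultimately show False by simp
qed

text \<open>
  The response is positive \<open>d\<close> steps before the end of the falling branch, as \<open>w\<close> is minus one at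
  its end. The symmetric point is then negative, so it cannot precede this one on a falling branch.
\<close>

lemma negative_phase_less_double_delay:
  assumes sq: "square_wave K a M b w" and loop: "relay_loop h (K + a + M + b) d w"
    and h: "antimono h" "increasing_differences h" "\<And>n. 0 \<le> h n"
    and major: "K < M \<or> K = M \<and> b \<le> a" and "1 < d"
  shows "M < 2 * d"
proof (rule ccontr)
  assume "\<not> M < 2 * d"
  then have M: "d \<le> M - d" "d \<le> M" by auto
  let ?Y = "falling_branch h K a M b"
  have a: "a \<le> 1" "b \<le> 1" "K \<ge> 1" "M \<ge> 1" using sq by (auto simp: square_wave_def)
  have "?Y (M - d) = cyclic_conv h (K + a + M + b) w (int (K + a + (M - d)) - 1)"
    using cyclic_conv_square_wave[OF sq, of "M - d"] by simp
  moreover have "w (int (K + a + (M - d)) - 1 + int d) = - 1"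
    using sq M a by (simp add: square_wave_def)
  ultimately have "?Y (M - d) > 0"
    using loop[unfolded relay_loop_def, rule_format, of "int (K + a + (M - d)) - 1"]
    by (simp add: sgn_if split: if_splits)
  moreover have "?Y d + ?Y (M - d) \<le> 0"
    using convex_symmetric_pair_le_ends[of ?Y d M, OF falling_branch_convex[OF h(2)] M(2)]
      falling_branch_ends[OF h a(1,2) major] by simp
  moreover have "?Y (M - d) \<le> ?Y d"
    using antimonoD[OF falling_branch_antimono[OF h(1)] M(1)] .
  ultimately show False by simp
qed

lemma square_wave_period_bounds:
  assumes sq: "square_wave K a M b w" and P: "P = K + a + M + b" and loop: "relay_loop h P d w"
    and h: "antimono h" "increasing_differences h" "\<And>n. 0 \<le> h n"
    and d: "1 < d" "d \<le> P"
  shows "2 * d \<le> P \<and> P \<le> 4 * d"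
proof -
  have P': "P = M + b + K + a" using P by simp
  note sq' = square_wave_half_turn[OF sq]
  note loop' = relay_loop_half_turn[OF loop, of "int (K + a)"]
  have "a \<le> 1" "b \<le> 1" using sq by (auto simp: square_wave_def)
  moreover have "d \<le> M + a"
    using delay_le_negative_phase[OF sq loop[unfolded P] h(1) d[unfolded P]] .
  moreover have "d \<le> K + b"
    using delay_le_negative_phase[OF sq' loop'[unfolded P'] h(1) d[unfolded P']] .
  moreover have "M < 2 * d \<and> K \<le> M \<or> K < 2 * d \<and> M \<le> K"
  proof (cases "K < M \<or> K = M \<and> b \<le> a")
    case True
    then show ?thesis
      using negative_phase_less_double_delay[OF sq loop[unfolded P] h True d(1)] by auto
  next
    case False
    then have "M < K \<or> M = K \<and> a \<le> b" by auto
    from negative_phase_less_double_delay[OF sq' loop'[unfolded P'] h this d(1)] this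
    show ?thesis by auto
  qed
  ultimately show ?thesis using P by auto
qed

section \<open>Cyclic variation and the shape of the relay output\<close>

lemma sign_change_between:
  assumes "i \<le> j" "sgn (f i) \<noteq> sgn (f j :: real)"
  shows "\<exists>k. i \<le> k \<and> k < j \<and> sgn (f k) \<noteq> sgn (f (Suc k))"
proof (rule ccontr)
  assume no: "\<not> ?thesis"
  have "sgn (f (i + n)) = sgn (f i)" if "i + n \<le> j" for n
    using that
  proof (induction n)
    case (Suc n)
    then show ?case using no by (metis Suc_leD add_Suc_right le_add1 less_eq_Suc_le)
  qed simp
  from this[of "j - i"] assms show False by simp
qed

lemma variation_ge_4:
  assumes nz: "0 \<notin> set r" and ord: "i0 < i1" "i1 < i2" "i2 < i3" "i3 < i4" "i4 < length r"
    and sg: "r ! i0 > 0" "r ! i1 < 0" "r ! i2 > 0" "r ! i3 < 0" "r ! i4 > 0"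
  shows "variation r \<ge> 4"
proof -
  let ?C = "{i. i + 1 < length r \<and> sgn (r ! i) \<noteq> sgn (r ! (i + 1))}"
  have filt: "filter (\<lambda>x. x \<noteq> 0) r = r" using nz by (auto simp: filter_id_conv)
  have "\<exists>k. i0 \<le> k \<and> k < i1 \<and> sgn (r ! k) \<noteq> sgn (r ! Suc k)"
    "\<exists>k. i1 \<le> k \<and> k < i2 \<and> sgn (r ! k) \<noteq> sgn (r ! Suc k)"
    "\<exists>k. i2 \<le> k \<and> k < i3 \<and> sgn (r ! k) \<noteq> sgn (r ! Suc k)"
    "\<exists>k. i3 \<le> k \<and> k < i4 \<and> sgn (r ! k) \<noteq> sgn (r ! Suc k)"
    using ord sg by (intro sign_change_between; simp)+
  then obtain k0 k1 k2 k3 where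
    k: "i0 \<le> k0" "k0 < i1" "i1 \<le> k1" "k1 < i2" "i2 \<le> k2" "k2 < i3" "i3 \<le> k3" "k3 < i4"
    and "sgn (r ! k0) \<noteq> sgn (r ! Suc k0)" "sgn (r ! k1) \<noteq> sgn (r ! Suc k1)"
      "sgn (r ! k2) \<noteq> sgn (r ! Suc k2)" "sgn (r ! k3) \<noteq> sgn (r ! Suc k3)"
    by metis
  then have "{k0, k1, k2, k3} \<subseteq> ?C" using ord by auto
  moreover have "finite ?C" by (rule finite_subset[of _ "{..<length r}"]) auto
  ultimately have "card {k0, k1, k2, k3} \<le> card ?C" by (intro card_mono)
  moreover have "card {k0, k1, k2, k3} = 4" using k by (simp add: card_insert_if)
  moreover have "r \<noteq> []" using ord by auto
  ultimately show ?thesis by (simp add: variation_def Let_def filt)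
qed

text \<open>
  Every zero of the period is filled, with a positive value at the two points that should be positive
  and a negative one elsewhere. The rotation that starts at \<open>p\<close> ends there as well and thus contains
  five alternating entries. A filling without zeros leaves nothing to delete in the variation.
\<close>

lemma no_weak_alternation:
  assumes var: "max_cyclic_variation (period_vec P u) \<le> 3" and per: "periodic_seq P u"
    and ord: "p < q" "q < r" "r < s" "s < p + int P"
    and sg: "u p \<ge> 0" "u q \<le> 0" "u r \<ge> 0" "u s \<le> 0"
  shows False
proof -
  define v where "v = period_vec P u"
  have P: "P > 0" using ord by auto
  define m where "m t = nat (t mod int P)" for t
  have m: "m t < P" "int (m t) = t mod int P" for t
    using P by (simp_all add: m_def nat_less_iff)
  have um: "u (int (m t)) = u t" for t by (simp add: m periodic_seq_mod[OF per])
  have m_neq: "m t \<noteq> m t'" if "t < t'" "t' < t + int P" for t t'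
  proof
    assume "m t = m t'"
    then have "t' mod int P = t mod int P" using m(2) by metis
    then have "int P dvd t' - t" by (simp add: mod_eq_dvd_iff)
    then show False using that zdvd_imp_le[of "int P" "t' - t"] by simp
  qed
  define w where "w = map (\<lambda>k. if u (int k) \<noteq> 0 then u (int k) else
      if k \<in> {m p, m r} then 1 else - 1) [0..<P]"
  have w: "length w = P" "w \<noteq> []" using P by (auto simp: w_def)
  have wm: "w ! m t = (if u t \<noteq> 0 then u t else if m t \<in> {m p, m r} then 1 else - 1)" for t
    using m(1) by (simp add: w_def um)
  have vw: "v \<noteq> []" "w \<in> zero_fillings v"
    using P by (auto simp: v_def w_def period_vec_def zero_fillings_def)
  define x where "x = drop (m p) w @ take (m p + 1) w"
  have len: "length x = P + 1" using m[of p] by (simp add: x_def w)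
  have nth: "x ! n = w ! m (p + int n)" if "n \<le> P" for n
  proof (cases "m p + n < P")
    case True
    have "(p + int n) mod int P = (int (m p) + int n) mod int P" by (simp add: m mod_add_left_eq)
    also have "\<dots> = int (m p + n)" using True by simp
    finally have "m (p + int n) = m p + n" using m(2)[of "p + int n"] by simp
    moreover have "n < P - m p" using True by linarith
    ultimately show ?thesis by (simp add: x_def nth_append w)
  next
    case False
    have "(p + int n) mod int P = (int (m p) + int n) mod int P" by (simp add: m mod_add_left_eq)
    also have "\<dots> = (int (m p + n - P) + int P) mod int P" using False by simp
    also have "\<dots> = int (m p + n - P) mod int P" by simp
    also have "\<dots> = int (m p + n - P)" using that m[of p] by simp
    finally have "m (p + int n) = m p + n - P" using m(2)[of "p + int n"] by simp
    moreover have "\<not> n < P - m p" using False by linarith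
    ultimately show ?thesis
      using that False m(1)[of p] by (simp add: x_def nth_append w add.commute)
  qed
  have neq: "m q \<noteq> m p" "m q \<noteq> m r" "m s \<noteq> m p" "m s \<noteq> m r"
    using m_neq[of p q] m_neq[of q r] m_neq[of p s] m_neq[of r s] ord by auto
  have "variation x \<ge> 4"
  proof (rule variation_ge_4[of _ 0 "nat (q - p)" "nat (r - p)" "nat (s - p)" P])
    show "0 \<notin> set x"
      using set_drop_subset[of "m p" w] set_take_subset[of "m p + 1" w]
      by (auto simp: x_def w_def split: if_splits)
    have "m (p + int P) = m p" by (simp add: m_def)
    then show "x ! 0 > 0" "x ! P > 0" using sg wm[of p] by (auto simp: nth)
    show "x ! nat (q - p) < 0" "x ! nat (r - p) > 0" "x ! nat (s - p) < 0"
      using ord sg neq by (auto simp: nth wm)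
  qed (use ord len in auto)
  also have "variation x \<le> cyclic_variation w"
    unfolding cyclic_variation_def using m(1)[of p] w by (intro Max_ge) (auto simp: x_def)
  also have "\<dots> \<le> max_cyclic_variation v"
    unfolding max_cyclic_variation_def
    using vw by (intro Max_ge finite_cyclic_variation_zero_fillings) auto
  finally show False using var by (simp add: v_def)
qed

text \<open>
  Shift a switch from nonpositive to positive to the origin and let \<open>K\<close> be the first index with a
  nonpositive value. The origin and \<open>K\<close> already form one alternation, so no later nonnegative value
  may be followed by a nonpositive one; as the last value of the period is nonpositive, everything
  strictly between \<open>K\<close> and the last index is negative. Zeros can occur only at these two indices.
\<close>

lemma exists_square_wave_shift:
  assumes per: "periodic_seq P u" and P: "P > 0"
    and var: "max_cyclic_variation (period_vec P u) \<le> 3"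
    and pos: "u p > 0" and neg: "u n < 0"
  shows "\<exists>s K a M b. P = K + a + M + b \<and> square_wave K a M b (\<lambda>t. sgn (u (t + s)))"
proof -
  \<comment> \<open>A negative value before \<open>p\<close>, so that the search to the left of \<open>p\<close> ends.\<close>
  obtain n' where n': "u n' < 0" "n' < p" "p \<le> n' + int P"
  proof
    define n' where "n' = p - 1 - ((p - 1 - n) mod int P)"
    have "n' = n + int P * ((p - 1 - n) div int P)"
      using minus_mod_eq_mult_div[of "p - 1 - n" "int P"] by (simp add: n'_def)
    then show "u n' < 0" using periodic_seq_mult[OF per] neg by simp
    show "n' < p" "p \<le> n' + int P"
      using P pos_mod_bound[of "int P" "p - 1 - n"] pos_mod_sign[of "int P" "p - 1 - n"]
      unfolding n'_def by linarith+
  qed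
  obtain s where s: "u s > 0" "u (s - 1) \<le> 0"
  proof -
    define k where "k = (LEAST k. u (p - int k) \<le> 0)"
    have ex: "u (p - int (nat (p - n'))) \<le> 0" using n' by simp
    have k: "u (p - int k) \<le> 0" unfolding k_def by (rule LeastI, rule ex)
    then have "k > 0" using pos by (cases k) auto
    moreover have "\<not> u (p - int (k - 1)) \<le> 0"
      unfolding k_def[symmetric] using \<open>k > 0\<close> by (intro not_less_Least[of "k - 1" "\<lambda>k. u (p - int k) \<le> 0", folded k_def]) simp
    ultimately show ?thesis
      using k by (intro that[of "p - int (k - 1)"]) (auto simp: of_nat_diff algebra_simps)
  qed
  define v where "v t = u (t + s)" for t
  have vper: "v (t + int P) = v t" for t
    using per[unfolded periodic_seq_def, rule_format, of "t + s"] by (simp add: v_def algebra_simps)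
  then have vP: "periodic_seq P v" by (simp add: periodic_seq_def)
  have v0: "v 0 > 0" using s by (simp add: v_def)
  have "v (- 1) \<le> 0" using s by (simp add: v_def)
  then have vend: "v (int P - 1) \<le> 0" using vper[of "- 1"] by simp
  have noalt: False if "0 < q" "q < r" "r < t" "t < int P" "v q \<le> 0" "v r \<ge> 0" "v t \<le> 0" for q r t
    using no_weak_alternation[OF var per, of s "q + s" "r + s" "t + s"] that v0 by (simp add: v_def)
  \<comment> \<open>This negative value ensures that the zeros at the two switches do not use up the whole phase.\<close>
  define m where "m = (n - s) mod int P"
  have m: "0 \<le> m" "m < int P" "v m < 0"
    using P neg periodic_seq_mod[OF vP, of "n - s"] by (simp_all add: m_def v_def)
  define K where "K = (LEAST k. v (int k) \<le> 0)"
  have ex: "v (int (P - 1)) \<le> 0" using vend P by (simp add: of_nat_diff)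
  have vK: "v (int K) \<le> 0" unfolding K_def by (rule LeastI, rule ex)
  have KP: "K \<le> P - 1" unfolding K_def by (rule Least_le, rule ex)
  have K1: "K \<ge> 1" using vK v0 by (cases K) auto
  have vpos: "v t > 0" if "0 \<le> t" "t < int K" for t
    using not_less_Least[of "nat t" "\<lambda>k. v (int k) \<le> 0", folded K_def] that
    by (simp add: nat_less_iff not_le)
  have vneg: "v t < 0" if "int K < t" "t < int P - 1" for t
    using noalt[of "int K" t "int P - 1"] that vK vend K1 by force
  define a where "a = (if v (int K) = 0 then 1 else 0 :: nat)"
  define b where "b = (if v (int P - 1) = 0 then 1 else 0 :: nat)"
  have Km: "int K \<le> m" using vpos[of m] m by force
  have mK: "m = int K \<Longrightarrow> a = 0" using m by (auto simp: a_def)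
  have mP: "m = int P - 1 \<Longrightarrow> b = 0" using m by (auto simp: b_def)
  have ab: "a \<le> 1" "b \<le> 1" by (auto simp: a_def b_def)
  have "K + a + b < P"
  proof (cases "m = int K")
    case True
    then show ?thesis using mK mP ab m KP P by (cases "m = int P - 1") auto
  next
    case False
    then show ?thesis using mP ab m Km by (cases "m = int P - 1") auto
  qed
  then obtain M where M: "P = K + a + M + b" "M \<ge> 1"
    by (intro that[of "P - (K + a + b)"]) auto
  have "square_wave K a M b (\<lambda>t. sgn (v t))"
    unfolding square_wave_def
  proof (intro conjI allI impI)
    show "periodic_seq (K + a + M + b) (\<lambda>t. sgn (v t))"
      using vper M by (simp add: periodic_seq_def)
  next
    fix t assume "0 \<le> t \<and> t < int K"
    then show "sgn (v t) = 1" using vpos by simp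
  next
    fix t assume t: "int K \<le> t \<and> t < int (K + a)"
    then have "t = int K" "a = 1" using ab by auto
    then show "sgn (v t) = 0" by (simp add: a_def split: if_splits)
  next
    fix t assume t: "int (K + a) \<le> t \<and> t < int (K + a + M)"
    have "v t < 0"
    proof (cases "t = int K")
      case True
      then show ?thesis using t vK by (auto simp: a_def split: if_splits)
    next
      case F: False
      show ?thesis
      proof (cases "t = int P - 1")
        case True
        then have "b = 0" using t M(1) by simp
        then have "v (int P - 1) \<noteq> 0" by (simp add: b_def split: if_splits)
        then show ?thesis using True vend by simp
      next
        case False
        then show ?thesis using t M(1) F by (intro vneg) linarith+
      qed
    qed
    then show "sgn (v t) = - 1" by simp
  next
    fix t assume t: "int (K + a + M) \<le> t \<and> t < int (K + a + M + b)"
    then have "t = int P - 1" "b = 1" using ab M(1) by linarith+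
    then show "sgn (v t) = 0" by (simp add: b_def split: if_splits)
  qed (use K1 M ab in auto)
  then show ?thesis using M unfolding v_def by blast
qed

section \<open>Periodisation of the impulse response\<close>

definition periodised :: "(int \<Rightarrow> real) \<Rightarrow> nat \<Rightarrow> nat \<Rightarrow> real" where
  "periodised g P j = (\<Sum>k. g (int (j + k * P)))"

context
  fixes g :: "int \<Rightarrow> real" and P :: nat
  assumes summ: "summable (\<lambda>n. g (int n))" and nonneg: "\<And>t. 0 \<le> g t" and P: "P > 0"
begin

lemma summable_periodised: "summable (\<lambda>k. g (int (j + k * P)))"
proof -
  have "inj (\<lambda>k. j + k * P)" using P by (auto simp: inj_on_def)
  then have "summable ((\<lambda>n. g (int n)) \<circ> (\<lambda>k. j + k * P))"
    using summ nonneg by (intro summable_reindex)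
  then show ?thesis by (simp add: o_def)
qed

lemma periodised_nonneg: "0 \<le> periodised g P j"
  unfolding periodised_def by (intro suminf_nonneg summable_periodised nonneg)

lemma periodised_antimono:
  assumes "\<And>n. g (int (Suc n)) \<le> g (int n)"
  shows "antimono (periodised g P)"
  unfolding periodised_def
  using assms by (intro decseq_SucI suminf_le summable_periodised) (metis add_Suc)

lemma periodised_convex:
  assumes "\<And>n. g (int (Suc n)) - g (int n) \<le> g (int (Suc (Suc n))) - g (int (Suc n))"
  shows "increasing_differences (periodised g P)"
  unfolding increasing_differences_def
proof
  fix j
  have "(\<Sum>k. g (int (Suc j + k * P)) - g (int (j + k * P)))
      \<le> (\<Sum>k. g (int (Suc (Suc j) + k * P)) - g (int (Suc j + k * P)))"
    using assms by (intro suminf_le summable_diff summable_periodised) (metis add_Suc)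
  then show "periodised g P (Suc j) - periodised g P j
      \<le> periodised g P (Suc (Suc j)) - periodised g P (Suc j)"
    unfolding periodised_def by (simp add: suminf_diff summable_periodised del: add_Suc of_nat_add)
qed

lemma conv_op_eq_cyclic_conv:
  assumes causal: "\<And>t. t < 0 \<Longrightarrow> g t = 0" and per: "periodic_seq P w" and bdd: "\<And>t. \<bar>w t\<bar> \<le> 1"
  shows "conv_op g w t = cyclic_conv (periodised g P) P w t"
proof -
  define f where "f n = g (int n) * w (t - int n)" for n
  have "norm (norm (f n)) \<le> g (int n)" for n
    using mult_left_le[OF bdd[of "t - int n"] nonneg[of "int n"]] nonneg[of "int n"]
    by (simp add: f_def abs_mult)
  then have norm: "summable (\<lambda>n. norm (f n))"
    by (intro summable_comparison_test[OF _ summ]) blast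
  have "conv_op g w t = infsum (\<lambda>\<tau>. g (t - \<tau>) * w \<tau>) ((\<lambda>n. t - int n) ` UNIV)"
    unfolding conv_op_def
  proof (rule infsum_cong_neutral)
    fix \<tau> assume "\<tau> \<in> UNIV - (\<lambda>n. t - int n) ` UNIV"
    moreover have "\<tau> = t - int (nat (t - \<tau>))" if "t - \<tau> \<ge> 0" using that by simp
    ultimately have "t - \<tau> < 0" by (metis DiffE not_less rangeI)
    then show "g (t - \<tau>) * w \<tau> = 0" by (simp add: causal)
  qed auto
  also have "\<dots> = infsum f UNIV"
    by (subst infsum_reindex) (auto simp: inj_on_def o_def f_def[abs_def])
  also have "\<dots> = (\<Sum>n. f n)"
    by (rule infsumI[OF norm_summable_imp_has_sum[OF norm summable_sums[OF summable_norm_cancel[OF norm]]]])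
  also have "\<dots> = cyclic_conv (periodised g P) P w t"
  proof (rule sums_unique2)
    show "(\<lambda>k. \<Sum>n\<in>{k * P..<k * P + P}. f n) sums (\<Sum>n. f n)"
      by (rule sums_group[OF summable_sums[OF summable_norm_cancel[OF norm]] P])
    have f: "f (k * P + j) = g (int (j + k * P)) * w (t - int j)" for j k
      using periodic_seq_mult[OF per, of "t - int j" "- int k"]
      by (simp add: f_def algebra_simps)
    have "(\<Sum>n\<in>{k * P..<k * P + P}. f n) = (\<Sum>j<P. g (int (j + k * P)) * w (t - int j))" for k
      using sum.shift_bounds_nat_ivl[of f 0 "k * P" P]
      by (simp add: f atLeast0LessThan add.commute[of _ "k * P"] add.commute[of P] del: of_nat_add)
    then show "(\<lambda>k. \<Sum>n\<in>{k * P..<k * P + P}. f n) sums cyclic_conv (periodised g P) P w t"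
      unfolding cyclic_conv_def periodised_def
      by (simp only:) (intro sums_sum sums_mult2 summable_sums summable_periodised)
  qed
  finally show ?thesis .
qed

end

section \<open>The oscillation period\<close>

lemma cyclic_variation_cyclic_diff_zero:
  assumes "P > 0" "\<And>t. u t = 0"
  shows "cyclic_variation (cyclic_diff (period_vec P u)) = - 1"
proof -
  define z where "z = cyclic_diff (period_vec P u)"
  have z: "length z = P" "\<forall>x\<in>set z. x = 0"
    using assms by (auto simp: z_def cyclic_diff_def period_vec_def)
  have "variation (drop i z @ take (i + 1) z) = - 1" for i
  proof -
    have "filter (\<lambda>x. x \<noteq> 0) (drop i z @ take (i + 1) z) = []"
      using z by (auto simp: filter_empty_conv dest: in_set_dropD in_set_takeD)
    then show ?thesis by (simp add: variation_def)
  qed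
  then have "(\<lambda>i. variation (drop i z @ take (i + 1) z)) ` {..<length z} = {- 1}"
    using z(1) assms(1) by auto
  then show ?thesis by (simp add: cyclic_variation_def flip: z_def)
qed

text \<open>
  The condition on the differences excludes \<open>u = 0\<close>; any other solution takes both signs, since a
  nonnegative kernel answers an input of one sign with an output of the opposite sign.
\<close>

theorem corollary2:
  fixes g0 :: "int \<Rightarrow> real" and P_d :: nat
  assumes "P_d > 1"
    and "finite_dim_causal_lti g0"
    and "(\<lambda>t. \<bar>g0 t\<bar>) summable_on UNIV"
    and "g0 0 > 0"
    and "{t. g0 t \<noteq> 0} = {0..}"
    and "strict_antimono_on {0..} g0"
    and "convex_seq g0"
  shows "\<forall>P u. P \<ge> P_d \<longrightarrow> periodic_seq P u \<longrightarrow> delayed_relay_feedback g0 P_d u \<longrightarrow>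
           cyclic_variation (cyclic_diff (period_vec P u)) = 2 \<longrightarrow>
           max_cyclic_variation (period_vec P u) = 2 \<longrightarrow>
           2 * P_d \<le> P \<and> P \<le> 4 * P_d + 2"
proof (intro allI impI)
  fix P :: nat and u :: "int \<Rightarrow> real"
  assume Pd: "P_d \<le> P" and per: "periodic_seq P u" and relay: "delayed_relay_feedback g0 P_d u"
    and cdiff: "cyclic_variation (cyclic_diff (period_vec P u)) = 2"
    and var: "max_cyclic_variation (period_vec P u) = 2"
  have P: "P > 0" using assms(1) Pd by simp
  have causal: "g0 t = 0" if "t < 0" for t
    using assms(2) that by (simp add: finite_dim_causal_lti_def)
  have "(\<lambda>n. \<bar>g0 (int n)\<bar>) summable_on UNIV"
  proof -
    have "(\<lambda>t. \<bar>g0 t\<bar>) summable_on range int"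
      using assms(3) by (rule summable_on_subset_banach) simp
    then show ?thesis by (simp add: summable_on_reindex o_def)
  qed
  then have summ: "summable (\<lambda>n. g0 (int n))"
    by (rule summable_rabs_cancel[OF summable_on_imp_summable])
  have dec: "g0 (int (Suc n)) \<le> g0 (int n)" for n
    using monotone_onD[OF assms(6), of "int n" "int (Suc n)"] by simp
  have nonneg: "0 \<le> g0 t" for t
  proof (cases "t < 0")
    case False
    have "decseq (\<lambda>n. g0 (int n))" using dec by (rule decseq_SucI)
    from decseq_ge[OF this summable_LIMSEQ_zero[OF summ], of "nat t"] False show ?thesis by simp
  qed (simp add: causal)
  have conv: "g0 (int (Suc n)) - g0 (int n) \<le> g0 (int (Suc (Suc n))) - g0 (int (Suc n))" for n
    using assms(7)[unfolded convex_seq_def, rule_format, of "int (Suc n)"] by (simp add: algebra_simps)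
  define h where "h = periodised g0 P"
  have h: "antimono h" "increasing_differences h" "\<And>n. 0 \<le> h n"
    unfolding h_def
    by (intro periodised_antimono periodised_convex periodised_nonneg summ nonneg P dec conv)+
  define w where "w t = sgn (u t)" for t
  have wper: "periodic_seq P w" using per by (simp add: periodic_seq_def w_def)
  have "u t = - conv_op g0 w (t - int P_d)" for t
    using relay unfolding delayed_relay_feedback_def w_def[abs_def] by blast
  moreover have "conv_op g0 w t = cyclic_conv h P w t" for t
    unfolding h_def
    by (rule conv_op_eq_cyclic_conv[OF summ nonneg P causal wper]) (auto simp: w_def abs_sgn_eq)
  ultimately have u: "u t = - cyclic_conv h P w (t - int P_d)" for t
    by metis
  have nonzero: "\<exists>t. u t \<noteq> 0"
    using cyclic_variation_cyclic_diff_zero[OF P, of u] cdiff by auto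
  have "\<exists>t. u t > 0"
  proof (rule ccontr)
    assume no: "\<not> ?thesis"
    then have "w t \<le> 0" for t by (simp add: w_def not_less)
    then have "u t \<ge> 0" for t
      unfolding u cyclic_conv_def by (simp add: sum_nonpos mult_nonneg_nonpos h(3))
    with no nonzero show False by (metis less_eq_real_def)
  qed
  moreover have "\<exists>t. u t < 0"
  proof (rule ccontr)
    assume no: "\<not> ?thesis"
    then have "w t \<ge> 0" for t by (simp add: w_def not_less)
    then have "u t \<le> 0" for t
      unfolding u cyclic_conv_def by (simp add: sum_nonneg h(3))
    with no nonzero show False by (metis less_eq_real_def)
  qed
  ultimately obtain s K a M b where sq: "P = K + a + M + b" "square_wave K a M b (\<lambda>t. w (t + s))"
    using exists_square_wave_shift[OF per P, of] var unfolding w_def by force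
  have "w (t + s + int P_d) = - sgn (cyclic_conv h P w (t + s))" for t
    using u[of "t + s + int P_d"] by (simp add: w_def[of "t + s + int P_d"] sgn_minus)
  then have "relay_loop h P P_d (\<lambda>t. w (t + s))"
    by (simp add: relay_loop_def cyclic_conv_def algebra_simps)
  from square_wave_period_bounds[OF sq(2,1) this h assms(1) Pd]
  show "2 * P_d \<le> P \<and> P \<le> 4 * P_d + 2" by simp
qed

end
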